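(* For odd positive integers $p$, and with parameters $k$ and $x$, $$\int_0^\pi \theta \sin^p \theta \left[(1+x\cos\theta)^{1/k}+(1-x\cos \theta)^{1/k}\right]d\theta=\frac{2^{(p+1)/2}\,\left(\frac{p-1}{2}\right)!\;\pi}{p!!}\; {}_2F_1\left(-\tfrac{1}{2k},\tfrac{k-1}{2k};\tfrac{p+2}{2};x^2\right).$$
   Context: Here $k$ and $x$ are parameters for which no explicit range is specified. ${}_2F_1$ is the Gauss hypergeometric function, ${}_2F_1(a,b;c;z)=\sum_{n\ge 0}\frac{(a)_n(b)_n}{(c)_n\,n!}z^n$, where $(a)_n=a(a+1)\cdots(a+n-1)$ is the Pochhammer symbol. For odd $p$, $p!!=1\cdot 3\cdot 5\cdots p$. *)

theory Defs
  imports "HOL-Analysis.Analysis"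
begin

definition hyp2F1_term :: "complex \<Rightarrow> complex \<Rightarrow> complex \<Rightarrow> complex \<Rightarrow> nat \<Rightarrow> complex" where
  "hyp2F1_term a b c z n = pochhammer a n * pochhammer b n / (pochhammer c n * fact n) * z ^ n"

text \<open>
  The Gauss function is the sum of its defining series. It is meaningful only where that series
  converges; no analytic continuation is intended.
\<close>
definition hyp2F1 :: "complex \<Rightarrow> complex \<Rightarrow> complex \<Rightarrow> complex \<Rightarrow> complex" where
  "hyp2F1 a b c z = (\<Sum>n. hyp2F1_term a b c z n)"

text \<open>The double factorial, for odd arguments only.\<close>
definition odd_double_fact :: "nat \<Rightarrow> nat" where
  "odd_double_fact p = \<Prod>{i \<in> {1..p}. odd i}"

end

theory Submission
  imports Defs "HOL-Real_Asymp.Real_Asymp"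
begin

text \<open>
  Put \<open>s = 1 / k\<close> and \<open>p = 2 * m + 1\<close>. The even part of the binomial series of \<open>(1 + x cos \<theta>) powr s\<close>
  is integrated term by term; the factor \<open>\<theta>\<close> contributes \<open>pi / 2\<close> by the symmetry about \<open>pi / 2\<close>.
  This settles \<open>norm x < 1\<close>, and every \<open>x\<close> if \<open>s\<close> is a natural number. Otherwise the hypergeometric
  series does not terminate, and its coefficients behave like \<open>C n powr (- w - 1)\<close> with \<open>C \<noteq> 0\<close> and
  \<open>w = s + m + 1\<close>, so convergence forces \<open>norm x \<le> 1\<close>, and \<open>Re w > 0\<close> if \<open>x\<^sup>2 = 1\<close>. On the unit circle
  the identity follows from the one for \<open>\<rho> x\<close> as \<open>\<rho>\<close> tends to \<open>1\<close>, by Abel's limit theorem for the series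
  and dominated convergence for the integral: \<open>Re w > 0\<close> is exactly what makes the integrand
  absolutely integrable at \<open>x\<^sup>2 = 1\<close>.
\<close>

section \<open>Trigonometric moments on \<open>{0..pi}\<close>\<close>

lemma odd_double_fact_Suc_Suc:
  "odd_double_fact (2 * Suc m + 1) = (2 * m + 3) * odd_double_fact (2 * m + 1)"
proof -
  have "{i \<in> {1..2 * Suc m + 1}. odd i} = insert (2 * m + 3) {i \<in> {1..2 * m + 1}. odd i}"
    by (auto simp: le_Suc_eq)
  moreover have "2 * m + 3 \<notin> {i \<in> {1..2 * m + 1}. odd i}"
    by simp
  ultimately show ?thesis
    unfolding odd_double_fact_def by (subst prod.insert[symmetric]) auto
qed

lemma odd_double_fact_pos: "odd_double_fact p > 0"
  unfolding odd_double_fact_def by (intro prod_pos) auto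

text \<open>Integration by parts in the form of an exact derivative:
  \<open>sin \<theta> ^ (2 * m + 2) * cos \<theta> ^ (2 * n + 1)\<close> vanishes at
  \<open>0\<close> and \<open>pi\<close>, and once \<open>sin^2\<close> is replaced by
  \<open>1 - cos^2\<close> its derivative combines two consecutive integrands. The ratio
  \<open>(2n + 1) / (2m + 2n + 3)\<close> is written with halves because it is the quotient of
  successive Pochhammer symbols.\<close>

lemma has_integral_sin_odd_cos_even_step:
  assumes "((\<lambda>\<theta>. sin \<theta> ^ (2 * m + 1) * cos \<theta> ^ (2 * n)) has_integral I) {0..pi}"
  shows "((\<lambda>\<theta>. sin \<theta> ^ (2 * m + 1) * cos \<theta> ^ (2 * Suc n)) has_integral
            (1 / 2 + real n) / (real m + 3 / 2 + real n) * I) {0..pi}"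
proof -
  define F where "F = (\<lambda>\<theta>::real. sin \<theta> ^ (2 * m + 2) * cos \<theta> ^ (2 * n + 1))"
  define f where "f = (\<lambda>\<theta>::real. real (2 * m + 2 * n + 3) * (sin \<theta> ^ (2 * m + 1) * cos \<theta> ^ (2 * Suc n))
                        - real (2 * n + 1) * (sin \<theta> ^ (2 * m + 1) * cos \<theta> ^ (2 * n)))"
  have "(F has_real_derivative f \<theta>) (at \<theta>)" for \<theta>
  proof -
    have "(F has_real_derivative (real (2 * m + 2) * (sin \<theta> ^ (2 * m + 1) * cos \<theta>) * cos \<theta> ^ (2 * n + 1)
            + sin \<theta> ^ (2 * m + 2) * (real (2 * n + 1) * (cos \<theta> ^ (2 * n) * (- sin \<theta>))))) (at \<theta>)"
      unfolding F_def
      using DERIV_mult[OF DERIV_power[OF DERIV_sin[of \<theta>], of "2 * m + 2"]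
                          DERIV_power[OF DERIV_cos[of \<theta>], of "2 * n + 1"]]
      by (simp add: algebra_simps)
    also have "real (2 * m + 2) * (sin \<theta> ^ (2 * m + 1) * cos \<theta>) * cos \<theta> ^ (2 * n + 1)
            + sin \<theta> ^ (2 * m + 2) * (real (2 * n + 1) * (cos \<theta> ^ (2 * n) * (- sin \<theta>)))
        = real (2 * m + 2) * (sin \<theta> ^ (2 * m + 1) * (cos \<theta> ^ (2 * n) * (cos \<theta>)\<^sup>2))
            - real (2 * n + 1) * (sin \<theta> ^ (2 * m + 1) * (cos \<theta> ^ (2 * n) * (sin \<theta>)\<^sup>2))"
      by (simp add: power2_eq_square)
    also have "\<dots> = f \<theta>"
      unfolding sin_squared_eq f_def by (simp add: algebra_simps power2_eq_square)
    finally show ?thesis .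
  qed
  then have "(f has_integral (F pi - F 0)) {0..pi}"
    by (intro fundamental_theorem_of_calculus)
       (auto simp: has_real_derivative_iff_has_vector_derivative[symmetric] intro: DERIV_subset)
  then have "(f has_integral 0) {0..pi}"
    by (simp add: F_def)
  from has_integral_add[OF this has_integral_mult_right[OF assms, of "real (2 * n + 1)"]]
  have "((\<lambda>\<theta>. real (2 * m + 2 * n + 3) * (sin \<theta> ^ (2 * m + 1) * cos \<theta> ^ (2 * Suc n)))
           has_integral real (2 * n + 1) * I) {0..pi}"
    by (simp add: f_def)
  from has_integral_mult_right[OF this, of "1 / real (2 * m + 2 * n + 3)"]
  have "((\<lambda>\<theta>. sin \<theta> ^ (2 * m + 1) * cos \<theta> ^ (2 * Suc n)) has_integral
           real (2 * n + 1) * I / real (2 * m + 2 * n + 3)) {0..pi}"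
    by (simp add: mult.assoc[symmetric] del: of_nat_add of_nat_mult of_nat_Suc)
  also have "real (2 * n + 1) * I / real (2 * m + 2 * n + 3)
               = (1 / 2 + real n) / (real m + 3 / 2 + real n) * I"
    by (simp add: field_simps)
  finally show ?thesis .
qed

text \<open>Going from \<open>m\<close> to \<open>m + 1\<close> splits off
  \<open>sin^2 = 1 - cos^2\<close>. The cosine part is the preceding reduction with
  \<open>n = 0\<close>, so the integral gains the factor \<open>(2m + 2) / (2m + 3)\<close>.\<close>

lemma has_integral_sin_odd:
  "((\<lambda>\<theta>. sin \<theta> ^ (2 * m + 1)) has_integral
      2 ^ (m + 1) * fact m / real (odd_double_fact (2 * m + 1))) {0..pi}"
proof (induction m)
  case 0
  have "((\<lambda>\<theta>. sin \<theta>) has_integral ((\<lambda>\<theta>. - cos \<theta>) pi - (\<lambda>\<theta>. - cos \<theta>) 0)) {0..pi}"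
    by (intro fundamental_theorem_of_calculus)
       (auto simp: has_real_derivative_iff_has_vector_derivative[symmetric]
             intro!: derivative_eq_intros)
  moreover have "odd_double_fact (Suc 0) = 1"
    unfolding odd_double_fact_def by (rule prod.neutral) auto
  ultimately show ?case by simp
next
  case (Suc m)
  let ?I = "2 ^ (m + 1) * fact m / real (odd_double_fact (2 * m + 1))"
  have 1: "((\<lambda>\<theta>. sin \<theta> ^ (2 * m + 1) * cos \<theta> ^ 2) has_integral
              (1 / 2) / (real m + 3 / 2) * ?I) {0..pi}"
    using has_integral_sin_odd_cos_even_step[of m 0 ?I] Suc by simp
  have "sin \<theta> ^ (2 * Suc m + 1) = sin \<theta> ^ (2 * m + 1) - sin \<theta> ^ (2 * m + 1) * cos \<theta> ^ 2" for \<theta> :: real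
  proof -
    have "sin \<theta> ^ (2 * Suc m + 1) = sin \<theta> ^ (2 * m + 1) * (sin \<theta>)\<^sup>2"
      by (simp add: power2_eq_square)
    then show ?thesis
      by (simp add: sin_squared_eq right_diff_distrib)
  qed
  then have "((\<lambda>\<theta>. sin \<theta> ^ (2 * Suc m + 1)) has_integral
               ?I - (1 / 2) / (real m + 3 / 2) * ?I) {0..pi}"
    using has_integral_diff[OF Suc 1] by simp
  also have "?I - (1 / 2) / (real m + 3 / 2) * ?I = (2 * real m + 2) / (2 * real m + 3) * ?I"
    by (simp add: divide_simps) (simp add: algebra_simps)
  also have "\<dots> = 2 ^ (Suc m + 1) * fact (Suc m) / real (odd_double_fact (2 * Suc m + 1))"
    unfolding odd_double_fact_Suc_Suc by (simp add: algebra_simps)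
  finally show ?case .
qed

lemma has_integral_sin_odd_cos_even:
  "((\<lambda>\<theta>. sin \<theta> ^ (2 * m + 1) * cos \<theta> ^ (2 * n)) has_integral
      2 ^ (m + 1) * fact m / real (odd_double_fact (2 * m + 1)) *
      (pochhammer (1 / 2) n / pochhammer (real m + 3 / 2) n)) {0..pi}"
proof (induction n)
  case 0
  then show ?case using has_integral_sin_odd[of m] by simp
next
  case (Suc n)
  from has_integral_sin_odd_cos_even_step[OF this] show ?case
    by (simp add: pochhammer_Suc mult_ac)
qed

text \<open>Reflecting \<open>t\<close> to \<open>c - t\<close> keeps the integral \<open>J\<close>
  of \<open>t * f t\<close> but changes the weight to \<open>c - t\<close>. The two weights add up
  to the constant \<open>c\<close>, so \<open>2 * J = c * I\<close>. Continuity guarantees that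
  \<open>J\<close> exists.\<close>

lemma has_integral_weighted_symmetric:
  fixes f :: "real \<Rightarrow> real"
  assumes cont: "continuous_on {0..c} f" and int: "(f has_integral I) {0..c}"
    and sym: "\<And>t. f (c - t) = f t"
  shows "((\<lambda>t. t * f t) has_integral c / 2 * I) {0..c}"
proof -
  have "(\<lambda>t. t * f t) integrable_on {0..c}"
    by (intro integrable_continuous_real continuous_intros cont)
  then obtain J where J: "((\<lambda>t. t * f t) has_integral J) {0..c}"
    by blast
  have "((\<lambda>t. (c - t) * f (c - t)) has_integral J) {0..c}"
  proof (cases "0 \<le> c")
    case True
    from has_integral_affinity[OF J[unfolded box_real(2)[symmetric]], of "-1" c] True show ?thesis
      by (simp add: image_diff_atLeastAtMost algebra_simps)
  next
    case False
    then show ?thesis using J by simp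
  qed
  then have "((\<lambda>t. (c - t) * f t) has_integral J) {0..c}"
    by (simp add: sym)
  from has_integral_add[OF J this] have "((\<lambda>t. c * f t) has_integral 2 * J) {0..c}"
    by (simp add: algebra_simps)
  from has_integral_unique[OF this has_integral_mult_right[OF int]] have "J = c / 2 * I"
    by simp
  with J show ?thesis by simp
qed

text \<open>The reflection about \<open>pi / 2\<close> fixes the sine and only changes the sign of
  the cosine, which occurs in an even power.\<close>

lemma has_integral_theta_sin_odd_cos_even:
  "((\<lambda>\<theta>. \<theta> * (sin \<theta> ^ (2 * m + 1) * cos \<theta> ^ (2 * n))) has_integral
      pi / 2 * (2 ^ (m + 1) * fact m / real (odd_double_fact (2 * m + 1)) *
      (pochhammer (1 / 2) n / pochhammer (real m + 3 / 2) n))) {0..pi}"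
  by (intro has_integral_weighted_symmetric has_integral_sin_odd_cos_even continuous_intros)
     (simp add: cos_diff sin_diff)

section \<open>Abel's limit theorem along real radii\<close>

text \<open>Summation by parts: with \<open>d n\<close> the error of the \<open>n\<close>-th partial
  sum, the power series differs from the sum \<open>S\<close> by
  \<open>(1 - r) * (\<Sum>n. d n * r ^ n)\<close>. Finitely many early errors are killed by
  \<open>1 - r\<close>. The later ones are at most \<open>e\<close>, and
  \<open>(1 - r) * (\<Sum>n. e * r ^ n) = e\<close>.\<close>

lemma abel_limit_theorem:
  fixes a :: "nat \<Rightarrow> 'a::{banach, real_normed_field}" and r :: "nat \<Rightarrow> real"
  assumes sum: "summable a" and r01: "\<And>j. 0 \<le> r j" "\<And>j. r j < 1" and r: "r \<longlonglongrightarrow> 1"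
  shows "(\<lambda>j. \<Sum>n. a n * of_real (r j) ^ n) \<longlonglongrightarrow> (\<Sum>n. a n)"
proof -
  define S where "S = (\<Sum>n. a n)"
  define d where "d n = (\<Sum>i\<le>n. a i) - S" for n
  have d0: "d \<longlonglongrightarrow> 0"
    using summable_LIMSEQ'[OF sum] unfolding d_def S_def by (rule LIM_zero)
  then have "Bseq d"
    using convergentI convergent_imp_Bseq by blast
  then obtain K where K: "\<And>n. norm (d n) \<le> K" "K > 0"
    by (auto simp: Bseq_def)
  have sd: "summable (\<lambda>n. norm (d n) * r j ^ n)" for j
    by (rule summable_comparison_test'[where g = "\<lambda>n. K * r j ^ n"])
       (use r01 K in \<open>auto simp: abs_mult intro!: summable_mult summable_geometric mult_right_mono\<close>)
  have sd': "summable (\<lambda>n. d n * of_real (r j) ^ n)" for j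
    by (rule summable_norm_cancel) (use sd[of j] r01 in \<open>simp add: norm_mult norm_power\<close>)
  have eq: "(\<Sum>n. a n * of_real (r j) ^ n) - S = of_real (1 - r j) * (\<Sum>n. d n * of_real (r j) ^ n)" for j
  proof -
    let ?z = "of_real (r j) :: 'a"
    have "(\<lambda>n. d n * ?z ^ n) sums (\<Sum>n. d n * ?z ^ n)"
      using sd' by (rule summable_sums)
    then have 1: "(\<lambda>n. d (Suc n) * ?z ^ Suc n) sums ((\<Sum>n. d n * ?z ^ n) - d 0)"
      using sums_Suc_iff[of "\<lambda>n. d n * ?z ^ n"] by simp
    have 2: "(\<lambda>n. ?z * (d n * ?z ^ n)) sums (?z * (\<Sum>n. d n * ?z ^ n))"
      using sd' by (intro sums_mult summable_sums)
    \<comment> \<open>Used here: \<open>a (Suc n) = d (Suc n) - d n\<close>. Index \<open>0\<close>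
      is restored afterwards, and \<open>a 0 - d 0 = S\<close> produces the limit.\<close>
    have "(\<lambda>n. a (Suc n) * ?z ^ Suc n) sums ((\<Sum>n. d n * ?z ^ n) - d 0 - ?z * (\<Sum>n. d n * ?z ^ n))"
      using sums_diff[OF 1 2] by (simp add: d_def algebra_simps)
    then have "(\<lambda>n. a n * ?z ^ n) sums ((\<Sum>n. d n * ?z ^ n) - d 0 - ?z * (\<Sum>n. d n * ?z ^ n) + a 0)"
      using sums_Suc_iff[of "\<lambda>n. a n * ?z ^ n"] by simp
    then have "(\<Sum>n. a n * ?z ^ n) = (\<Sum>n. d n * ?z ^ n) - d 0 - ?z * (\<Sum>n. d n * ?z ^ n) + a 0"
      by (rule sums_unique[symmetric])
    then show ?thesis
      by (simp add: d_def algebra_simps)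
  qed
  have bound: "norm ((\<Sum>n. a n * of_real (r j) ^ n) - S) \<le> (1 - r j) * (\<Sum>n<N. norm (d n)) + e"
    if N: "\<And>n. n \<ge> N \<Longrightarrow> norm (d n) \<le> e" and e: "e > 0" for N e j
  proof -
    have "norm (\<Sum>n. d n * of_real (r j) ^ n) \<le> (\<Sum>n. norm (d n) * r j ^ n)"
      using summable_norm[of "\<lambda>n. d n * of_real (r j) ^ n"] sd[of j] r01
      by (simp add: norm_mult norm_power)
    also have "\<dots> = (\<Sum>n. norm (d (n + N)) * r j ^ (n + N)) + (\<Sum>n<N. norm (d n) * r j ^ n)"
      by (rule suminf_split_initial_segment[OF sd])
    also have "(\<Sum>n<N. norm (d n) * r j ^ n) \<le> (\<Sum>n<N. norm (d n))"
      using r01[of j] by (intro sum_mono mult_left_le power_le_one) auto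
    also have "(\<Sum>n. norm (d (n + N)) * r j ^ (n + N)) \<le> (\<Sum>n. e * r j ^ n)"
    proof (rule suminf_le)
      show "norm (d (n + N)) * r j ^ (n + N) \<le> e * r j ^ n" for n
        using r01[of j] e N[of "n + N"]
        by (intro mult_mono power_decreasing) auto
      show "summable (\<lambda>n. norm (d (n + N)) * r j ^ (n + N))"
        using summable_ignore_initial_segment[OF sd] by simp
      show "summable (\<lambda>n. e * r j ^ n)"
        using r01[of j] by (intro summable_mult summable_geometric) auto
    qed
    also have "(\<Sum>n. e * r j ^ n) = e / (1 - r j)"
      using r01[of j] by (simp add: suminf_mult suminf_geometric summable_geometric)
    finally have "norm (\<Sum>n. d n * of_real (r j) ^ n) \<le> e / (1 - r j) + (\<Sum>n<N. norm (d n))"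
      by simp
    then have "(1 - r j) * norm (\<Sum>n. d n * of_real (r j) ^ n)
               \<le> (1 - r j) * (e / (1 - r j) + (\<Sum>n<N. norm (d n)))"
      using r01[of j] by (intro mult_left_mono) auto
    also have "\<dots> = (1 - r j) * (\<Sum>n<N. norm (d n)) + e"
      using r01[of j] by (simp add: algebra_simps divide_simps)
    finally show ?thesis
      unfolding eq norm_mult norm_of_real using r01[of j] by simp
  qed
  have "(\<lambda>j. (\<Sum>n. a n * of_real (r j) ^ n) - S) \<longlonglongrightarrow> 0"
  proof (rule tendstoI)
    fix e :: real assume e: "e > 0"
    then have "eventually (\<lambda>n. norm (d n) < e / 2) sequentially"
      using tendstoD[OF d0, of "e / 2"] by simp
    then obtain N where N: "\<And>n. n \<ge> N \<Longrightarrow> norm (d n) \<le> e / 2"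
      by (force simp: eventually_sequentially)
    have "(\<lambda>j. (1 - r j) * (\<Sum>n<N. norm (d n))) \<longlonglongrightarrow> (1 - 1) * (\<Sum>n<N. norm (d n))"
      by (intro tendsto_intros r)
    then have "eventually (\<lambda>j. (1 - r j) * (\<Sum>n<N. norm (d n)) < e / 2) sequentially"
      by (rule order_tendstoD) (use e in simp)
    then show "eventually (\<lambda>j. dist ((\<Sum>n. a n * of_real (r j) ^ n) - S) 0 < e) sequentially"
    proof eventually_elim
      case (elim j)
      then show ?case using bound[of N "e / 2" j] N e by simp
    qed
  qed
  then show ?thesis
    unfolding S_def by (rule LIM_zero_cancel)
qed


section \<open>Termwise integration of the binomial series\<close>

text \<open>The integrand of the theorem with \<open>s = 1 / k\<close>. The complex
  \<open>powr\<close> is the principal branch, with \<open>0 powr s = 0\<close>.\<close>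

definition theta_sin_powr :: "nat \<Rightarrow> complex \<Rightarrow> complex \<Rightarrow> real \<Rightarrow> complex" where
  "theta_sin_powr p s x \<theta> = of_real \<theta> * of_real (sin \<theta>) ^ p *
     ((1 + x * of_real (cos \<theta>)) powr s + (1 - x * of_real (cos \<theta>)) powr s)"

text \<open>Twice the weighted moment for \<open>n = 0\<close>. The factor 2 comes from adding the
  binomial series at \<open>w\<close> and \<open>- w\<close>, which doubles the even terms.\<close>

definition theta_sin_const :: "nat \<Rightarrow> complex" where
  "theta_sin_const m = 2 ^ (m + 1) * fact m * of_real pi / of_nat (odd_double_fact (2 * m + 1))"

lemma theta_sin_const_nonzero: "theta_sin_const m \<noteq> 0"
  using odd_double_fact_pos[of "2 * m + 1"] by (simp add: theta_sin_const_def)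

text \<open>Source of the two upper parameters: duplication splits
  \<open>pochhammer (- s) (2 * n)\<close> into the two symbols on the right, times
  \<open>4 ^ n\<close>. The same duplication for \<open>fact (2 * n)\<close> yields
  \<open>4 ^ n\<close>, \<open>pochhammer (1 / 2) n\<close> and \<open>fact n\<close>, of which the
  first two cancel.\<close>

lemma gbinomial_even_times_pochhammer_half:
  fixes s :: "'a::field_char_0"
  shows "(s gchoose (2 * n)) * pochhammer (1 / 2) n
           = pochhammer (- s / 2) n * pochhammer ((1 - s) / 2) n / fact n"
proof -
  have "pochhammer (- s) (2 * n) = 2 ^ (2 * n) * pochhammer (- s / 2) n * pochhammer ((1 - s) / 2) n"
    using pochhammer_double[of "- s / 2" n] by (simp add: diff_divide_distrib)
  \<comment> \<open>It is a factor of the nonzero \<open>fact (2 * n)\<close>.\<close>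
  moreover have "pochhammer (1 / 2 :: 'a) n \<noteq> 0"
    using fact_double[of n, where 'a = 'a] fact_nonzero[of "2 * n", where 'a = 'a] by auto
  ultimately show ?thesis
    by (simp add: gbinomial_pochhammer fact_double)
qed

lemma sums_even_part:
  fixes f :: "nat \<Rightarrow> 'a::real_normed_field"
  assumes "(\<lambda>n. f n * w ^ n) sums S" "(\<lambda>n. f n * (- w) ^ n) sums T"
  shows "(\<lambda>n. 2 * f (2 * n) * w ^ (2 * n)) sums (S + T)"
proof -
  have "(\<lambda>n. f n * w ^ n + f n * (- w) ^ n) sums (S + T)"
    using assms by (rule sums_add)
  then have "(\<lambda>n. f (2 * n) * w ^ (2 * n) + f (2 * n) * (- w) ^ (2 * n)) sums (S + T)"
  proof (subst sums_mono_reindex[of "\<lambda>n. 2 * n"])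
    fix n :: nat assume "n \<notin> range (\<lambda>n. 2 * n)"
    then have "odd n" by (auto elim: evenE)
    then show "f n * w ^ n + f n * (- w) ^ n = 0" by simp
  qed (auto simp: strict_mono_def)
  then show ?thesis by (simp add: algebra_simps)
qed

text \<open>Common core of the cases \<open>norm x < 1\<close> and natural \<open>s\<close>. Since
  \<open>\<bar>cos \<theta>\<bar> \<le> 1\<close>, absolute summability at \<open>x\<close> gives a
  Weierstrass majorant uniform in \<theta>, so limit and integral may be exchanged.\<close>

lemma has_integral_theta_sin_powr_termwise:
  assumes abs: "summable (\<lambda>n. norm ((s gchoose n) * x ^ n))"
    and sums: "\<And>t::real. \<bar>t\<bar> \<le> 1 \<Longrightarrow>
                 (\<lambda>n. (s gchoose n) * (x * of_real t) ^ n) sums (1 + x * of_real t) powr s"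
  shows "(theta_sin_powr (2 * m + 1) s x has_integral
            theta_sin_const m * hyp2F1 (- s / 2) ((1 - s) / 2) (of_nat m + 3 / 2) (x\<^sup>2)) {0..pi}"
proof -
  define t where "t = hyp2F1_term (- s / 2) ((1 - s) / 2) (of_nat m + 3 / 2) (x\<^sup>2)"
  define f where "f n \<theta> = of_real \<theta> * of_real (sin \<theta>) ^ (2 * m + 1) *
      (2 * (s gchoose (2 * n)) * (x * of_real (cos \<theta>)) ^ (2 * n))" for n and \<theta> :: real
  have f_int: "(f n has_integral theta_sin_const m * t n) {0..pi}" for n
  proof -
    have "((\<lambda>\<theta>. 2 * (s gchoose (2 * n)) * x ^ (2 * n) *
              complex_of_real (\<theta> * (sin \<theta> ^ (2 * m + 1) * cos \<theta> ^ (2 * n)))) has_integral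
            2 * (s gchoose (2 * n)) * x ^ (2 * n) *
              of_real (pi / 2 * (2 ^ (m + 1) * fact m / real (odd_double_fact (2 * m + 1)) *
      (pochhammer (1 / 2) n / pochhammer (real m + 3 / 2) n)))) {0..pi}"
      by (intro has_integral_mult_right has_integral_of_real has_integral_theta_sin_odd_cos_even)
    also have "(\<lambda>\<theta>. 2 * (s gchoose (2 * n)) * x ^ (2 * n) *
              complex_of_real (\<theta> * (sin \<theta> ^ (2 * m + 1) * cos \<theta> ^ (2 * n)))) = f n"
      by (simp add: fun_eq_iff f_def power_mult_distrib)
    also have "2 * (s gchoose (2 * n)) * x ^ (2 * n) *
              complex_of_real (pi / 2 * (2 ^ (m + 1) * fact m / real (odd_double_fact (2 * m + 1)) *
                (pochhammer (1 / 2) n / pochhammer (real m + 3 / 2) n)))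
        = theta_sin_const m * (((s gchoose (2 * n)) * pochhammer (1 / 2) n) /
             pochhammer (of_nat m + 3 / 2) n * x ^ (2 * n))"
      by (simp add: theta_sin_const_def pochhammer_of_real[symmetric])
    also have "\<dots> = theta_sin_const m * t n"
      unfolding gbinomial_even_times_pochhammer_half t_def hyp2F1_term_def
      by (simp add: power_mult[symmetric] mult_ac)
    finally show ?thesis .
  qed
  have f_sums: "(\<lambda>n. f n \<theta>) sums theta_sin_powr (2 * m + 1) s x \<theta>" for \<theta>
    unfolding f_def theta_sin_powr_def
    using sums[of "cos \<theta>"] sums[of "- cos \<theta>"] by (intro sums_mult sums_even_part) simp_all
  have "uniform_limit {0..pi} (\<lambda>n \<theta>. \<Sum>i<n. f i \<theta>) (\<lambda>\<theta>. \<Sum>i. f i \<theta>) sequentially"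
  proof (rule Weierstrass_m_test)
    show "norm (f n \<theta>) \<le> 2 * pi * norm ((s gchoose (2 * n)) * x ^ (2 * n))"
      if "\<theta> \<in> {0..pi}" for n \<theta>
    proof -
      have "norm (f n \<theta>) = \<theta> * \<bar>sin \<theta>\<bar> ^ (2 * m + 1) * \<bar>cos \<theta>\<bar> ^ (2 * n) *
              (2 * norm ((s gchoose (2 * n)) * x ^ (2 * n)))"
        using that by (simp add: f_def norm_mult norm_power power_mult_distrib)
      also have "\<dots> \<le> pi * 1 * 1 * (2 * norm ((s gchoose (2 * n)) * x ^ (2 * n)))"
        using that by (intro mult_mono power_le_one) auto
      finally show ?thesis by simp
    qed
    have "summable ((\<lambda>n. norm ((s gchoose n) * x ^ n)) \<circ> (\<lambda>n. 2 * n))"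
      by (rule summable_reindex[OF abs]) (auto simp: inj_on_def)
    then show "summable (\<lambda>n. 2 * pi * norm ((s gchoose (2 * n)) * x ^ (2 * n)))"
      by (intro summable_mult) (simp add: o_def)
  qed
  moreover have "(\<lambda>\<theta>. \<Sum>i. f i \<theta>) = theta_sin_powr (2 * m + 1) s x"
    using f_sums by (simp add: fun_eq_iff sums_iff)
  ultimately have "uniform_limit {0..pi} (\<lambda>n \<theta>. \<Sum>i<n. f i \<theta>) (theta_sin_powr (2 * m + 1) s x) sequentially"
    by simp
  moreover have "continuous_on {0..pi} (\<lambda>\<theta>. \<Sum>i<n. f i \<theta>)" for n
    unfolding f_def by (intro continuous_intros)
  ultimately obtain I J where IJ: "\<And>n. ((\<lambda>\<theta>. \<Sum>i<n. f i \<theta>) has_integral I n) {0..pi}"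
      "(theta_sin_powr (2 * m + 1) s x has_integral J) {0..pi}" "I \<longlonglongrightarrow> J"
    by (rule uniform_limit_integral) auto
  have "I = (\<lambda>n. \<Sum>i<n. theta_sin_const m * t i)"
    using has_integral_unique[OF IJ(1) has_integral_sum[OF finite_lessThan f_int]] by blast
  with IJ(3) have "(\<lambda>i. theta_sin_const m * t i) sums J"
    unfolding sums_def by simp
  \<comment> \<open>Convergence of the hypergeometric series is a result here: the exchange makes
    the scaled partial sums converge, and the nonzero constant divides out.\<close>
  from sums_divide[OF this, of "theta_sin_const m"] have "t sums (J / theta_sin_const m)"
    by (simp add: theta_sin_const_nonzero)
  then have "J = theta_sin_const m * (\<Sum>n. t n)"
    by (simp add: sums_iff theta_sin_const_nonzero)
  with IJ(2) show ?thesis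
    by (simp add: hyp2F1_def t_def)
qed

lemma has_integral_theta_sin_powr_inside:
  assumes "norm x < 1"
  shows "(theta_sin_powr (2 * m + 1) s x has_integral
            theta_sin_const m * hyp2F1 (- s / 2) ((1 - s) / 2) (of_nat m + 3 / 2) (x\<^sup>2)) {0..pi}"
proof (rule has_integral_theta_sin_powr_termwise)
  show "summable (\<lambda>n. norm ((s gchoose n) * x ^ n))"
    using assms by (intro abs_summable_in_conv_radius) (simp add: conv_radius_gchoose)
  show "(\<lambda>n. (s gchoose n) * (x * of_real t) ^ n) sums (1 + x * of_real t) powr s"
    if "\<bar>t\<bar> \<le> 1" for t :: real
  proof (rule gen_binomial_complex)
    have "norm (x * of_real t) \<le> norm x * 1"
      unfolding norm_mult norm_of_real using that by (intro mult_left_mono) auto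
    then show "norm (x * of_real t) < 1" using assms by simp
  qed
qed

text \<open>The binomial series is a polynomial and its radius of convergence is infinite, so no
  bound on \<open>x\<close> is required.\<close>

lemma has_integral_theta_sin_powr_Nats:
  assumes "s \<in> \<nat>" "s \<noteq> 0"
  shows "(theta_sin_powr (2 * m + 1) s x has_integral
            theta_sin_const m * hyp2F1 (- s / 2) ((1 - s) / 2) (of_nat m + 3 / 2) (x\<^sup>2)) {0..pi}"
proof (rule has_integral_theta_sin_powr_termwise)
  show "summable (\<lambda>n. norm ((s gchoose n) * x ^ n))"
    using assms by (intro abs_summable_in_conv_radius) (simp add: conv_radius_gchoose)
  from assms obtain N where N: "s = of_nat N" "N > 0"
    by (auto elim!: Nats_cases)
  show "(\<lambda>n. (s gchoose n) * (x * of_real t) ^ n) sums (1 + x * of_real t) powr s" for t :: real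
  proof -
    define w where "w = x * of_real t"
    have "(\<lambda>n. (s gchoose n) * w ^ n) sums (\<Sum>n\<le>N. (s gchoose n) * w ^ n)"
      by (rule sums_finite) (auto simp: N binomial_gbinomial[symmetric])
    also have "(\<Sum>n\<le>N. (s gchoose n) * w ^ n) = (w + 1) ^ N"
      by (simp add: binomial_ring N binomial_gbinomial[symmetric])
    \<comment> \<open>At \<open>w = -1\<close> the convention \<open>0 powr s = 0\<close> agrees
      with \<open>0 ^ N\<close> because \<open>N > 0\<close>.\<close>
    also have "\<dots> = (1 + w) powr s"
      by (cases "w + 1 = 0") (use N in \<open>simp_all add: add.commute\<close>)
    finally show ?thesis by (simp add: w_def)
  qed
qed

section \<open>Necessary conditions for convergence of the hypergeometric series\<close>

text \<open>Three Gauss products for the reciprocal Gamma function are combined.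
  \<open>rGamma_series z n\<close> contains \<open>pochhammer z (Suc n)\<close> but
  \<open>fact n\<close>, whence the index \<open>Suc n\<close> of the term and the factor
  \<open>of_nat (Suc n)\<close>. The limit is nonzero unless \<open>a\<close>, \<open>b\<close> or
  \<open>c\<close> is a pole of Gamma.\<close>

lemma hyp2F1_term_asymptotics:
  assumes "c \<notin> \<int>\<^sub>\<le>\<^sub>0"
  shows "(\<lambda>n. of_nat (Suc n) * exp ((c - a - b) * of_real (ln (real n))) * hyp2F1_term a b c 1 (Suc n))
           \<longlonglongrightarrow> rGamma a * rGamma b / rGamma c"
proof -
  have "(\<lambda>n. rGamma_series a n * rGamma_series b n / rGamma_series c n)
          \<longlonglongrightarrow> rGamma a * rGamma b / rGamma c"
    using assms by (intro tendsto_intros) (simp add: rGamma_eq_zero_iff)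
  also have "(\<lambda>n. rGamma_series a n * rGamma_series b n / rGamma_series c n) =
    (\<lambda>n. of_nat (Suc n) * exp ((c - a - b) * of_real (ln (real n))) * hyp2F1_term a b c 1 (Suc n))"
    by (simp add: fun_eq_iff rGamma_series_def hyp2F1_term_def left_diff_distrib exp_diff
          divide_simps del: of_nat_Suc)
  finally show ?thesis .
qed

lemma hyp2F1_term_altdef: "hyp2F1_term a b c z n = hyp2F1_term a b c 1 n * z ^ n"
  by (simp add: hyp2F1_term_def)

text \<open>If \<open>norm z > 1\<close>, the factor \<open>(n + 1) * n powr w / z ^ (n + 1)\<close>
  tends to 0, and so do the terms. Their product is free of \<open>z\<close> and would tend to 0,
  against its nonzero asymptotic limit.\<close>

lemma norm_le_1_if_summable_hyp2F1_term:
  assumes a: "a \<notin> \<int>\<^sub>\<le>\<^sub>0" and b: "b \<notin> \<int>\<^sub>\<le>\<^sub>0" and c: "c \<notin> \<int>\<^sub>\<le>\<^sub>0"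
    and sum: "summable (hyp2F1_term a b c z)"
  shows "norm z \<le> 1"
proof (rule ccontr)
  assume "\<not> norm z \<le> 1"
  then have z: "norm z > 1" by simp
  define w where "w = c - a - b"
  define \<sigma> where "\<sigma> = Re w"
  define R where "R = norm z"
  have "(\<lambda>n. real (Suc n) * exp (\<sigma> * ln (real n)) / R ^ Suc n) \<longlonglongrightarrow> 0"
    using z unfolding R_def[symmetric] by real_asymp
  then have 1: "(\<lambda>n. of_nat (Suc n) * exp (w * of_real (ln (real n))) / z ^ Suc n) \<longlonglongrightarrow> 0"
    by (subst tendsto_norm_zero_iff[symmetric])
       (simp add: norm_mult norm_divide norm_power \<sigma>_def R_def del: of_nat_Suc power_Suc)
  have 2: "(\<lambda>n. hyp2F1_term a b c z (Suc n)) \<longlonglongrightarrow> 0"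
    using summable_LIMSEQ_zero[OF sum] by (rule LIMSEQ_Suc)
  have "(\<lambda>n. of_nat (Suc n) * exp (w * of_real (ln (real n))) / z ^ Suc n
           * hyp2F1_term a b c z (Suc n)) \<longlonglongrightarrow> 0"
    using tendsto_mult[OF 1 2] by simp
  also have "(\<lambda>n. of_nat (Suc n) * exp (w * of_real (ln (real n))) / z ^ Suc n
               * hyp2F1_term a b c z (Suc n))
    = (\<lambda>n. of_nat (Suc n) * exp (w * of_real (ln (real n))) * hyp2F1_term a b c 1 (Suc n))"
  proof
    fix n
    have "z \<noteq> 0" using z by auto
    then show "of_nat (Suc n) * exp (w * of_real (ln (real n))) / z ^ Suc n
               * hyp2F1_term a b c z (Suc n)
      = of_nat (Suc n) * exp (w * of_real (ln (real n))) * hyp2F1_term a b c 1 (Suc n)"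
      by (subst hyp2F1_term_altdef[of _ _ _ z]) simp
  qed
  finally have "rGamma a * rGamma b / rGamma c = 0"
    using LIMSEQ_unique[OF hyp2F1_term_asymptotics[OF c]] unfolding w_def by blast
  then show False
    using a b c by (simp add: rGamma_eq_zero_iff)
qed

text \<open>Dividing by \<open>L\<close> turns the limit into 1, so that
  \<open>2 * Re (t n / L)\<close> eventually dominates the harmonic series.\<close>

lemma not_summable_if_times_n_tendsto_nonzero:
  fixes t :: "nat \<Rightarrow> complex"
  assumes lim: "(\<lambda>n. of_nat n * t n) \<longlonglongrightarrow> L" and "L \<noteq> 0"
  shows "\<not> summable t"
proof
  assume "summable t"
  then have sum: "summable (\<lambda>n. 2 * Re (t n / L))"
    by (intro summable_mult summable_Re summable_divide)
  have "(\<lambda>n. Re (of_nat n * t n / L)) \<longlonglongrightarrow> Re (L / L)"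
    using \<open>L \<noteq> 0\<close> by (intro tendsto_intros lim)
  then have "eventually (\<lambda>n. Re (of_nat n * t n / L) > 1 / 2) sequentially"
    by (rule order_tendstoD) (use \<open>L \<noteq> 0\<close> in simp)
  then have "eventually (\<lambda>n. norm (inverse (of_nat n) :: real) \<le> 2 * Re (t n / L)) sequentially"
    using eventually_gt_at_top[of 0]
  proof eventually_elim
    case (elim n)
    have "of_nat n * t n / L = of_real (real n) * (t n / L)" by simp
    then have "real n * Re (t n / L) > 1 / 2"
      using elim(1) by (metis Re_complex_of_real Im_complex_of_real diff_zero mult_zero_left times_complex.simps(1))
    then show ?case using elim(2) by (simp add: field_simps)
  qed
  from summable_comparison_test_ev[OF this sum] show False
    using not_summable_harmonic by blast
qed

lemma norm_exp_times_ln_le_1: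
  assumes "Re w \<le> 0" "n > 0"
  shows "norm (exp (w * of_real (ln (real n)))) \<le> 1"
  using assms by (simp add: mult_nonpos_nonneg)

text \<open>
  With \<open>t\<close> the sequence of terms and \<open>w = c - a - b\<close>, the telescoping identity
  \<open>(n + 1) t (n + 1) - n t n = (- w + (a b + w c) / (c + n)) t n\<close> shows that \<open>n t n\<close> converges
  as soon as the series does. Its limit must vanish, by comparison with the harmonic series,
  and this contradicts \<open>n t n \<sim> C n powr (- w)\<close> if \<open>Re w \<le> 0\<close>.
\<close>
lemma Re_pos_if_summable_hyp2F1_term_at_1:
  assumes a: "a \<notin> \<int>\<^sub>\<le>\<^sub>0" and b: "b \<notin> \<int>\<^sub>\<le>\<^sub>0" and c: "Re c > 0"
    and sum: "summable (hyp2F1_term a b c 1)"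
  shows "Re (c - a - b) > 0"
proof (rule ccontr)
  assume not_pos: "\<not> Re (c - a - b) > 0"
  define t where "t = hyp2F1_term a b c 1"
  define w where "w = c - a - b"
  define E where "E n = exp (w * of_real (ln (real n)))" for n
  define C where "C = rGamma a * rGamma b / rGamma c"
  have c': "c \<notin> \<int>\<^sub>\<le>\<^sub>0"
    using c by (auto elim!: nonpos_Ints_cases)
  have w: "Re w \<le> 0"
    using not_pos by (simp add: w_def)
  have C: "C \<noteq> 0"
    using a b c' by (simp add: C_def rGamma_eq_zero_iff)
  have lim: "(\<lambda>n. of_nat (Suc n) * E n * t (Suc n)) \<longlonglongrightarrow> C"
    using hyp2F1_term_asymptotics[OF c', of a b] by (simp add: E_def w_def t_def C_def)
  have norm_E: "norm (E n) = real n powr Re w" if "n > 0" for n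
    using that by (simp add: E_def powr_def)
  have t0: "t \<longlonglongrightarrow> 0"
    using summable_LIMSEQ_zero[OF sum] by (simp add: t_def)
  \<comment> \<open>A preliminary bound, needed for \<open>sum2\<close>. If
    \<open>Re w \<le> -1\<close>, the factor \<open>(n + 1) * E n\<close> stays bounded by 2, and
    terms tending to 0 already contradict \<open>C \<noteq> 0\<close>.\<close>
  have w': "Re w > -1"
  proof (rule ccontr)
    assume "\<not> Re w > -1"
    then have "Re w \<le> -1" by simp
    have 1: "eventually (\<lambda>n. norm (of_nat (Suc n) * E n * t (Suc n)) \<le> 2 * norm (t (Suc n))) sequentially"
      using eventually_gt_at_top[of 0]
    proof eventually_elim
      case (elim n)
      have "real n powr Re w \<le> real n powr (-1)"
        using elim \<open>Re w \<le> -1\<close> by (intro powr_mono) auto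
      also have "\<dots> = 1 / real n"
        using elim by (simp add: powr_minus divide_simps)
      finally have "real (Suc n) * real n powr Re w \<le> real (Suc n) * (1 / real n)"
        by (intro mult_left_mono) auto
      also have "\<dots> \<le> 2" using elim by (simp add: field_simps)
      finally have "real (Suc n) * real n powr Re w \<le> 2" .
      then show ?case
        using elim unfolding norm_mult norm_E[OF elim] norm_of_nat by (intro mult_right_mono) auto
    qed
    have "(\<lambda>n. 2 * norm (t (Suc n))) \<longlonglongrightarrow> 2 * norm (0 :: complex)"
      by (intro tendsto_intros LIMSEQ_Suc[OF t0])
    then have "(\<lambda>n. 2 * norm (t (Suc n))) \<longlonglongrightarrow> 0" by simp
    from Lim_null_comparison[OF 1 this]
    have "(\<lambda>n. of_nat (Suc n) * E n * t (Suc n)) \<longlonglongrightarrow> 0" .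
    with lim C show False using LIMSEQ_unique by blast
  qed
  have c_n: "norm (c + of_nat n) \<ge> real n" for n
    using complex_Re_le_cmod[of "c + of_nat n"] c by simp
  have c_nz: "c + of_nat n \<noteq> 0" for n
    using c by (auto simp: complex_eq_iff)
  \<comment> \<open>The asymptotics bound \<open>t (Suc n)\<close> by a multiple of
    \<open>n powr (-1 - Re w)\<close>. Division by \<open>c + n\<close> lowers the exponent to
    \<open>-2 - Re w\<close>, which is below -1 by \<open>w'\<close>.\<close>
  have sum2: "summable (\<lambda>n. t n / (c + of_nat n))"
  proof -
    obtain K where K: "\<And>n. norm (of_nat (Suc n) * E n * t (Suc n)) \<le> K"
      using convergent_imp_Bseq[OF convergentI[OF lim]] by (auto simp: Bseq_def)
    have "eventually (\<lambda>n. norm (t (Suc n) / (c + of_nat (Suc n))) \<le> K * real n powr (-2 - Re w)) sequentially"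
      using eventually_gt_at_top[of 0]
    proof eventually_elim
      case (elim n)
      have "real n * real n powr Re w * norm (t (Suc n)) \<le> real (Suc n) * real n powr Re w * norm (t (Suc n))"
        by (intro mult_right_mono) auto
      also have "\<dots> \<le> K"
        using K[of n] norm_E[OF elim] by (simp add: norm_mult del: of_nat_Suc)
      finally have 1: "real n * real n powr Re w * norm (t (Suc n)) \<le> K" .
      have "norm (t (Suc n) / (c + of_nat (Suc n))) \<le> norm (t (Suc n)) / real n"
        unfolding norm_divide using c_n[of "Suc n"] elim by (intro divide_left_mono mult_pos_pos) auto
      also have "\<dots> = real n * real n powr Re w * norm (t (Suc n)) * real n powr (-2 - Re w)"
        using elim by (simp add: powr_diff powr_minus powr_numeral field_simps power2_eq_square)
      also have "\<dots> \<le> K * real n powr (-2 - Re w)"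
        using 1 by (intro mult_right_mono) auto
      finally show ?case .
    qed
    moreover have "summable (\<lambda>n. K * real n powr (-2 - Re w))"
      using w' by (intro summable_mult) (simp add: summable_real_powr_iff)
    ultimately have "summable (\<lambda>n. t (Suc n) / (c + of_nat (Suc n)))"
      by (rule summable_comparison_test_ev)
    then show ?thesis
      using summable_Suc_iff[of "\<lambda>n. t n / (c + of_nat n)"] by simp
  qed
  define v where "v n = of_nat n * t n" for n
  have v_diff: "v (Suc n) - v n = (a * b + w * c) * (t n / (c + of_nat n)) - w * t n" for n
  proof -
    have "pochhammer c n \<noteq> 0"
      using c' pochhammer_eq_0_imp_nonpos_Int by blast
    then have "t (Suc n) = (a + of_nat n) * (b + of_nat n) / ((c + of_nat n) * of_nat (Suc n)) * t n"
      using c_nz[of n] by (simp add: t_def hyp2F1_term_def pochhammer_Suc mult_ac)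
    then have "v (Suc n) = (a + of_nat n) * (b + of_nat n) / (c + of_nat n) * t n"
      by (simp add: v_def del: of_nat_Suc)
    then show ?thesis
      using c_nz[of n] by (simp add: v_def w_def divide_simps) (simp add: algebra_simps)
  qed
  have "summable (\<lambda>n. v (Suc n) - v n)"
    unfolding v_diff using sum by (intro summable_diff summable_mult sum2) (simp add: t_def)
  then have "convergent (\<lambda>n. v n - v 0)"
    by (simp add: summable_iff_convergent sum_lessThan_telescope)
  then obtain M where "(\<lambda>n. v n - v 0) \<longlonglongrightarrow> M"
    by (auto simp: convergent_def)
  from tendsto_add[OF this tendsto_const[of "v 0"]] have v: "v \<longlonglongrightarrow> M + v 0"
    by simp
  have "M + v 0 = 0"
    using not_summable_if_times_n_tendsto_nonzero[OF v[unfolded v_def]] sum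
    by (auto simp: t_def v_def)
  with v have "(\<lambda>n. v (Suc n)) \<longlonglongrightarrow> 0"
    using LIMSEQ_Suc[OF v] by simp
  then have v0: "(\<lambda>n. norm (v (Suc n))) \<longlonglongrightarrow> 0"
    by (rule tendsto_norm_zero)
  have "eventually (\<lambda>n. norm (of_nat (Suc n) * E n * t (Suc n)) \<le> norm (v (Suc n))) sequentially"
    using eventually_gt_at_top[of 0]
  proof eventually_elim
    case (elim n)
    then have "norm (E n) * norm (v (Suc n)) \<le> 1 * norm (v (Suc n))"
      unfolding E_def by (intro mult_right_mono norm_exp_times_ln_le_1 w) auto
    then show ?case by (simp add: v_def norm_mult mult_ac del: of_nat_Suc)
  qed
  from Lim_null_comparison[OF this v0]
  have "(\<lambda>n. of_nat (Suc n) * E n * t (Suc n)) \<longlonglongrightarrow> 0" .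
  with lim C show False using LIMSEQ_unique by blast
qed

section \<open>Passage to the unit circle\<close>

text \<open>Reduces the boundary case to one integrable majorant \<open>h\<close> valid for all
  radii \<rho>. The open interval leaves out the endpoints, where a base may vanish and pointwise
  convergence may fail; the integral does not change.\<close>

lemma has_integral_theta_sin_powr_boundary:
  assumes x: "norm x \<le> 1"
    and sum: "summable (hyp2F1_term (- s / 2) ((1 - s) / 2) (of_nat m + 3 / 2) (x\<^sup>2))"
    and h: "h integrable_on {0<..<pi}"
    and le: "\<And>\<rho> \<theta>. 0 \<le> \<rho> \<Longrightarrow> \<rho> < 1 \<Longrightarrow> \<theta> \<in> {0<..<pi} \<Longrightarrow>
               norm (theta_sin_powr (2 * m + 1) s (of_real \<rho> * x) \<theta>) \<le> h \<theta>"
  shows "(theta_sin_powr (2 * m + 1) s x has_integral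
            theta_sin_const m * hyp2F1 (- s / 2) ((1 - s) / 2) (of_nat m + 3 / 2) (x\<^sup>2)) {0..pi}"
proof -
  define \<rho> where "\<rho> j = real j / real (Suc j)" for j
  define t where "t = hyp2F1_term (- s / 2) ((1 - s) / 2) (of_nat m + 3 / 2)"
  have \<rho>: "0 \<le> \<rho> j" "\<rho> j < 1" for j
    by (simp_all add: \<rho>_def)
  have \<rho>_lim: "\<rho> \<longlonglongrightarrow> 1"
    unfolding \<rho>_def by (rule LIMSEQ_n_over_Suc_n)
  have norm_\<rho>: "norm (of_real (\<rho> j) * x) < 1" for j
  proof -
    have "norm (of_real (\<rho> j) * x) \<le> \<rho> j * 1"
      unfolding norm_mult norm_of_real using \<rho>[of j] x by (intro mult_mono) auto
    then show ?thesis using \<rho>[of j] by simp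
  qed
  have int: "(theta_sin_powr (2 * m + 1) s (of_real (\<rho> j) * x) has_integral
               theta_sin_const m * (\<Sum>n. t ((of_real (\<rho> j) * x)\<^sup>2) n)) {0<..<pi}" for j
    using has_integral_theta_sin_powr_inside[OF norm_\<rho>[of j], of m s]
    by (simp add: has_integral_Icc_iff_Ioo hyp2F1_def t_def)
  \<comment> \<open>The series depends on \<open>x\<^sup>2\<close>, so Abel's theorem is applied
    along the squared radii.\<close>
  have "t ((of_real (\<rho> j) * x)\<^sup>2) n = t (x\<^sup>2) n * of_real ((\<rho> j)\<^sup>2) ^ n" for j n
    by (simp add: t_def hyp2F1_term_def power_mult_distrib)
  moreover have "(\<lambda>j. \<Sum>n. t (x\<^sup>2) n * of_real ((\<rho> j)\<^sup>2) ^ n) \<longlonglongrightarrow> (\<Sum>n. t (x\<^sup>2) n)"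
  proof (rule abel_limit_theorem)
    show "summable (t (x\<^sup>2))" using sum by (simp add: t_def)
    show "(\<rho> j)\<^sup>2 < 1" for j using \<rho>[of j] by (simp add: power_less_one_iff)
    show "(\<lambda>j. (\<rho> j)\<^sup>2) \<longlonglongrightarrow> 1" using tendsto_power[OF \<rho>_lim, of 2] by simp
  qed auto
  ultimately have lim: "(\<lambda>j. theta_sin_const m * (\<Sum>n. t ((of_real (\<rho> j) * x)\<^sup>2) n))
                    \<longlonglongrightarrow> theta_sin_const m * (\<Sum>n. t (x\<^sup>2) n)"
    by (intro tendsto_intros) simp
  have conv: "(\<lambda>j. theta_sin_powr (2 * m + 1) s (of_real (\<rho> j) * x) \<theta>)
                \<longlonglongrightarrow> theta_sin_powr (2 * m + 1) s x \<theta>" if \<theta>: "\<theta> \<in> {0<..<pi}" for \<theta>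
  proof -
    have "norm (x * of_real (cos \<theta>)) < 1"
    proof -
      have "sin \<theta> > 0" using \<theta> by (intro sin_gt_zero) auto
      then have "(cos \<theta>)\<^sup>2 < 1\<^sup>2" by (simp add: cos_squared_eq)
      then have "\<bar>cos \<theta>\<bar> < 1" by (simp add: abs_square_less_1)
      moreover have "norm (x * of_real (cos \<theta>)) \<le> 1 * \<bar>cos \<theta>\<bar>"
        unfolding norm_mult norm_of_real using x by (intro mult_right_mono) auto
      ultimately show ?thesis by simp
    qed
    then have "\<bar>Re (x * of_real (cos \<theta>))\<bar> < 1"
      using abs_Re_le_cmod order.strict_trans1 by blast
    \<comment> \<open>Both bases have positive real part and stay off the branch cut, where
      \<open>powr\<close> is continuous.\<close>
    then have nz: "1 + x * of_real (cos \<theta>) \<notin> \<real>\<^sub>\<le>\<^sub>0" "1 - x * of_real (cos \<theta>) \<notin> \<real>\<^sub>\<le>\<^sub>0"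
      by (auto simp: complex_nonpos_Reals_iff)
    have "(\<lambda>j. of_real (\<rho> j) * x) \<longlonglongrightarrow> of_real 1 * x"
      by (intro tendsto_intros \<rho>_lim)
    then have "(\<lambda>j. of_real (\<rho> j) * x) \<longlonglongrightarrow> x" by simp
    with nz show ?thesis
      unfolding theta_sin_powr_def by (intro tendsto_intros) auto
  qed
  have f: "theta_sin_powr (2 * m + 1) s (of_real (\<rho> j) * x) integrable_on {0<..<pi}" for j
    using int by blast
  note dom = dominated_convergence[where f = "\<lambda>j. theta_sin_powr (2 * m + 1) s (of_real (\<rho> j) * x)",
      OF f h le[OF \<rho>] conv]
  have eq: "integral {0<..<pi} (theta_sin_powr (2 * m + 1) s (of_real (\<rho> j) * x))
      = theta_sin_const m * (\<Sum>n. t ((of_real (\<rho> j) * x)\<^sup>2) n)" for j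
    using int by (rule integral_unique)
  have "(theta_sin_powr (2 * m + 1) s x has_integral theta_sin_const m * (\<Sum>n. t (x\<^sup>2) n)) {0<..<pi}"
    using dom(1) LIMSEQ_unique[OF lim dom(2)[unfolded eq]]
    by (simp add: has_integral_integrable_integral)
  then show ?thesis
    by (simp add: has_integral_Icc_iff_Ioo hyp2F1_def t_def)
qed

text \<open>For \<open>x\<close> other than 1 and -1 the segment of all \<open>1 + x * t\<close>
  with \<open>\<bar>t\<bar> \<le> 1\<close> is compact and avoids the branch cut. Its powers are
  therefore bounded, and a constant serves as majorant.\<close>

lemma has_integral_theta_sin_powr_circle:
  assumes x: "norm x = 1" and x2: "x\<^sup>2 \<noteq> 1"
    and sum: "summable (hyp2F1_term (- s / 2) ((1 - s) / 2) (of_nat m + 3 / 2) (x\<^sup>2))"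
  shows "(theta_sin_powr (2 * m + 1) s x has_integral
            theta_sin_const m * hyp2F1 (- s / 2) ((1 - s) / 2) (of_nat m + 3 / 2) (x\<^sup>2)) {0..pi}"
proof -
  have nz: "1 + x * of_real t \<notin> \<real>\<^sub>\<le>\<^sub>0" if t: "t \<in> {-1..1}" for t :: real
  proof
    assume "1 + x * of_real t \<in> \<real>\<^sub>\<le>\<^sub>0"
    then have Re: "Re x * t \<le> -1" and Im: "Im x * t = 0"
      by (auto simp: complex_nonpos_Reals_iff)
    from Re have "t \<noteq> 0" by auto
    with Im have "Im x = 0" by simp
    then have "x = of_real (Re x)" by (simp add: complex_eq_iff)
    then have "x = 1 \<or> x = -1"
      using x by (metis abs_eq_iff abs_1 norm_of_real of_real_1 of_real_minus)
    with x2 show False by auto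
  qed
  have "compact ((\<lambda>t::real. (1 + x * of_real t) powr s) ` {-1..1})"
  proof (intro compact_continuous_image continuous_on_powr_complex)
    show "{-1..1} \<subseteq> {t. 0 \<le> Re (1 + x * of_real t) \<or> Im (1 + x * of_real t) \<noteq> 0}"
    proof
      fix t :: real assume "t \<in> {-1..1}"
      from nz[OF this] show "t \<in> {t. 0 \<le> Re (1 + x * of_real t) \<or> Im (1 + x * of_real t) \<noteq> 0}"
        unfolding complex_nonpos_Reals_iff mem_Collect_eq by linarith
    qed
    \<comment> \<open>Vacuous: by \<open>nz\<close> the base never vanishes.\<close>
    show "0 < Re s" if "t \<in> {-1..1}" "1 + x * of_real t = 0" for t :: real
      using nz[OF that(1)] unfolding that(2) by simp
  qed (intro continuous_intros compact_Icc)+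
  then have "bounded ((\<lambda>t::real. (1 + x * of_real t) powr s) ` {-1..1})"
    by (rule compact_imp_bounded)
  then obtain B where B: "\<And>t::real. t \<in> {-1..1} \<Longrightarrow> norm ((1 + x * of_real t) powr s) \<le> B"
    unfolding bounded_iff by blast
  show ?thesis
  proof (rule has_integral_theta_sin_powr_boundary)
    show "(\<lambda>_. pi * (B + B)) integrable_on {0<..<pi}"
      unfolding integrable_on_Icc_iff_Ioo[symmetric] by (rule integrable_const_ivl)
    show "norm (theta_sin_powr (2 * m + 1) s (of_real \<rho> * x) \<theta>) \<le> pi * (B + B)"
      if \<rho>: "0 \<le> \<rho>" "\<rho> < 1" and \<theta>: "\<theta> \<in> {0<..<pi}" for \<rho> \<theta>
    proof -
      have "\<bar>\<rho> * cos \<theta>\<bar> \<le> 1 * 1"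
        unfolding abs_mult using \<rho> by (intro mult_mono) auto
      then have "\<rho> * cos \<theta> \<in> {-1..1}" "- (\<rho> * cos \<theta>) \<in> {-1..1}"
        by auto
      from B[OF this(1)] B[OF this(2)]
      have 1: "norm ((1 + of_real \<rho> * x * of_real (cos \<theta>)) powr s) \<le> B"
        and 2: "norm ((1 - of_real \<rho> * x * of_real (cos \<theta>)) powr s) \<le> B"
        by (simp_all add: mult_ac)
      have "\<bar>\<theta>\<bar> * \<bar>sin \<theta>\<bar> ^ (2 * m + 1) \<le> pi * 1"
        using \<theta> by (intro mult_mono power_le_one) auto
      then show ?thesis
        unfolding theta_sin_powr_def norm_mult norm_power norm_of_real
        by (intro mult_mono order.trans[OF norm_triangle_ineq add_mono[OF 1 2]]) auto
    qed
  qed (use x sum in simp_all)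
qed

text \<open>The integrand may be unbounded at the endpoints, but it has an explicit antiderivative
  that is continuous on the closed interval because \<open>q + 1 > 0\<close>.\<close>

lemma integrable_sin_times_powr:
  fixes q :: real
  assumes "q > -1"
  shows "(\<lambda>\<theta>. sin \<theta> * ((1 - cos \<theta>) powr q + (1 + cos \<theta>) powr q)) integrable_on {0..pi}"
proof -
  define F where "F = (\<lambda>\<theta>::real. ((1 - cos \<theta>) powr (q + 1) - (1 + cos \<theta>) powr (q + 1)) / (q + 1))"
  have "((\<lambda>\<theta>. sin \<theta> * ((1 - cos \<theta>) powr q + (1 + cos \<theta>) powr q)) has_integral (F pi - F 0)) {0..pi}"
  proof (rule fundamental_theorem_of_calculus_interior)
    show "continuous_on {0..pi} F"
      unfolding F_def using assms
      by (intro continuous_on_divide continuous_on_diff continuous_on_add continuous_on_powr'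
                continuous_on_const continuous_on_cos continuous_on_id)
         (auto simp: add.commute[of 1] real_0_le_add_iff)
    fix \<theta> :: real assume \<theta>: "\<theta> \<in> {0<..<pi}"
    then have "sin \<theta> > 0" by (intro sin_gt_zero) auto
    then have "(cos \<theta>)\<^sup>2 < 1" by (simp add: cos_squared_eq)
    then have c: "\<bar>cos \<theta>\<bar> < 1" by (simp add: abs_square_less_1)
    have "((\<lambda>\<theta>. 1 - cos \<theta>) has_real_derivative sin \<theta>) (at \<theta>)"
      by (auto intro!: derivative_eq_intros)
    then have 1: "((\<lambda>\<theta>. (1 - cos \<theta>) powr (q + 1)) has_real_derivative
                (q + 1) * (1 - cos \<theta>) powr q * sin \<theta>) (at \<theta>)"
      using DERIV_fun_powr[of "\<lambda>\<theta>. 1 - cos \<theta>" "sin \<theta>" \<theta> "q + 1"] c by simp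
    have "((\<lambda>\<theta>. 1 + cos \<theta>) has_real_derivative - sin \<theta>) (at \<theta>)"
      by (auto intro!: derivative_eq_intros)
    then have 2: "((\<lambda>\<theta>. (1 + cos \<theta>) powr (q + 1)) has_real_derivative
                (q + 1) * (1 + cos \<theta>) powr q * (- sin \<theta>)) (at \<theta>)"
      using DERIV_fun_powr[of "\<lambda>\<theta>. 1 + cos \<theta>" "- sin \<theta>" \<theta> "q + 1"] c by simp
    have "(F has_real_derivative ((q + 1) * (1 - cos \<theta>) powr q * sin \<theta>
             - (q + 1) * (1 + cos \<theta>) powr q * (- sin \<theta>)) / (q + 1)) (at \<theta>)"
      unfolding F_def by (intro DERIV_cdivide DERIV_diff 1 2)
    also have "((q + 1) * (1 - cos \<theta>) powr q * sin \<theta>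
             - (q + 1) * (1 + cos \<theta>) powr q * (- sin \<theta>)) / (q + 1)
        = sin \<theta> * ((1 - cos \<theta>) powr q + (1 + cos \<theta>) powr q)"
      using assms by (simp add: field_simps)
    finally have "(F has_real_derivative sin \<theta> * ((1 - cos \<theta>) powr q + (1 + cos \<theta>) powr q)) (at \<theta>)" .
    then show "(F has_vector_derivative sin \<theta> * ((1 - cos \<theta>) powr q + (1 + cos \<theta>) powr q)) (at \<theta>)"
      by (simp add: has_real_derivative_iff_has_vector_derivative)
  qed simp
  then show ?thesis by blast
qed

text \<open>The modulus is \<open>norm z powr Re s * exp (- Im s * Arg z)\<close>, and
  \<open>Arg\<close> is bounded by \<open>pi\<close>. For \<open>Re s \<ge> 0\<close> the upper
  bound on \<open>norm z\<close> decides, otherwise the lower bound \<open>d\<close>; the exponent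
  \<open>min (Re s) 0\<close> covers both.\<close>

lemma norm_powr_le_near_circle:
  fixes z s :: complex
  assumes d: "0 < d" "d \<le> 1" and z: "d \<le> norm z" "norm z \<le> 2"
  shows "norm (z powr s) \<le> 2 powr \<bar>Re s\<bar> * exp (pi * \<bar>Im s\<bar>) * d powr min (Re s) 0"
proof -
  have "norm z powr Re s \<le> 2 powr \<bar>Re s\<bar> * d powr min (Re s) 0"
  proof (cases "Re s \<ge> 0")
    case True
    then show ?thesis using z d by (simp add: powr_mono2)
  next
    case False
    then have "norm z powr Re s \<le> d powr Re s"
      using z d by (intro powr_mono2') auto
    also have "\<dots> \<le> 2 powr \<bar>Re s\<bar> * d powr Re s"
      using mult_right_mono[of 1 "2 powr \<bar>Re s\<bar>" "d powr Re s"] ge_one_powr_ge_zero[of 2 "\<bar>Re s\<bar>"]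
      by simp
    finally show ?thesis using False by simp
  qed
  moreover have "- Im s * Arg z \<le> pi * \<bar>Im s\<bar>"
  proof -
    have "\<bar>Im s\<bar> * \<bar>Arg z\<bar> \<le> \<bar>Im s\<bar> * pi"
      using Arg_bounded[of z] by (intro mult_left_mono) auto
    then show ?thesis
      using abs_ge_self[of "- Im s * Arg z"] by (simp add: abs_mult mult.commute)
  qed
  ultimately have "norm z powr Re s * exp (- Im s * Arg z)
      \<le> (2 powr \<bar>Re s\<bar> * d powr min (Re s) 0) * exp (pi * \<bar>Im s\<bar>)"
    by (intro mult_mono) auto
  then show ?thesis
    by (simp add: norm_powr_complex mult_ac)
qed

text \<open>With \<open>d = 1 - \<bar>cos \<theta>\<bar>\<close>, both bases have modulus between
  \<open>d\<close> and 2 for every radius \<rho>. The possible singularity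
  \<open>d powr min (Re s) 0\<close> is weakened by
  \<open>sin \<theta> ^ (2 * m) \<le> (2 * d) ^ m\<close>, and the remaining single sine makes
  \<open>d powr q\<close> integrable for \<open>q > -1\<close>.\<close>

lemma has_integral_theta_sin_powr_at_1:
  assumes x2: "x\<^sup>2 = 1" and s: "Re s + real m > -1"
    and sum: "summable (hyp2F1_term (- s / 2) ((1 - s) / 2) (of_nat m + 3 / 2) (x\<^sup>2))"
  shows "(theta_sin_powr (2 * m + 1) s x has_integral
            theta_sin_const m * hyp2F1 (- s / 2) ((1 - s) / 2) (of_nat m + 3 / 2) (x\<^sup>2)) {0..pi}"
proof -
  define q where "q = min (Re s) 0 + real m"
  define K where "K = 2 powr \<bar>Re s\<bar> * exp (pi * \<bar>Im s\<bar>)"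
  have q: "q > -1" using s by (simp add: q_def min_def)
  have K: "K > 0" by (simp add: K_def)
  have x: "norm x = 1"
    using x2 by (metis norm_one norm_power power2_eq_1_iff norm_minus_cancel)
  show ?thesis
  proof (rule has_integral_theta_sin_powr_boundary)
    show "(\<lambda>\<theta>. 2 * K * pi * 2 ^ m * (sin \<theta> * ((1 - cos \<theta>) powr q + (1 + cos \<theta>) powr q)))
            integrable_on {0<..<pi}"
      unfolding integrable_on_Icc_iff_Ioo[symmetric]
      by (intro integrable_on_mult_right integrable_sin_times_powr q)
    show "norm (theta_sin_powr (2 * m + 1) s (of_real \<rho> * x) \<theta>)
            \<le> 2 * K * pi * 2 ^ m * (sin \<theta> * ((1 - cos \<theta>) powr q + (1 + cos \<theta>) powr q))"
      if \<rho>: "0 \<le> \<rho>" "\<rho> < 1" and \<theta>: "\<theta> \<in> {0<..<pi}" for \<rho> \<theta>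
    proof -
      define d where "d = 1 - \<bar>cos \<theta>\<bar>"
      have sin: "sin \<theta> > 0" using \<theta> by (intro sin_gt_zero) auto
      then have "(cos \<theta>)\<^sup>2 < 1" by (simp add: cos_squared_eq)
      then have "\<bar>cos \<theta>\<bar> < 1" by (simp add: abs_square_less_1)
      then have d: "0 < d" "d \<le> 1" by (simp_all add: d_def)
      define u where "u = of_real \<rho> * x * of_real (cos \<theta>)"
      have "norm u \<le> 1 * \<bar>cos \<theta>\<bar>"
        unfolding u_def norm_mult norm_of_real x using \<rho> by (intro mult_mono) auto
      then have u: "norm u \<le> 1 - d" by (simp add: d_def)
      have "d \<le> norm (1 + u)" "norm (1 + u) \<le> 2" "d \<le> norm (1 - u)" "norm (1 - u) \<le> 2"
        using u d norm_triangle_ineq[of 1 u] norm_triangle_ineq4[of 1 u]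
          norm_triangle_ineq2[of 1 u] norm_triangle_ineq2[of 1 "-u"] by auto
      then have pow: "norm ((1 + u) powr s) \<le> K * d powr min (Re s) 0"
          "norm ((1 - u) powr s) \<le> K * d powr min (Re s) 0"
        unfolding K_def using d by (blast intro: norm_powr_le_near_circle)+
      have "(sin \<theta>)\<^sup>2 = d * (1 + \<bar>cos \<theta>\<bar>)"
        by (simp add: d_def sin_squared_eq algebra_simps power2_eq_square)
      also have "\<dots> \<le> d * 2"
        using d by (intro mult_left_mono) auto
      finally have "((sin \<theta>)\<^sup>2) ^ m \<le> (d * 2) ^ m"
        by (intro power_mono) auto
      then have sin_pow: "sin \<theta> ^ (2 * m + 1) \<le> sin \<theta> * (2 ^ m * d ^ m)"
        using sin by (simp add: power_mult[symmetric] power_mult_distrib mult_ac)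
      have d_q: "d ^ m * d powr min (Re s) 0 = d powr q"
        using d by (simp add: q_def powr_add powr_realpow)
      \<comment> \<open>By the sign of the cosine, \<open>d\<close> equals
        \<open>1 - cos \<theta>\<close> or \<open>1 + cos \<theta>\<close>.\<close>
      have d_le: "d powr q \<le> (1 - cos \<theta>) powr q + (1 + cos \<theta>) powr q"
        by (cases "cos \<theta> \<ge> 0") (auto simp: d_def)
      have "norm (theta_sin_powr (2 * m + 1) s (of_real \<rho> * x) \<theta>)
              = \<theta> * sin \<theta> ^ (2 * m + 1) * norm ((1 + u) powr s + (1 - u) powr s)"
        using \<theta> sin unfolding theta_sin_powr_def u_def norm_mult norm_power norm_of_real by simp
      also have "\<dots> \<le> pi * (sin \<theta> * (2 ^ m * d ^ m)) * (K * d powr min (Re s) 0 + K * d powr min (Re s) 0)"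
        using \<theta> sin d sin_pow
        by (intro mult_mono order.trans[OF norm_triangle_ineq add_mono[OF pow]]) auto
      also have "\<dots> = 2 * K * pi * 2 ^ m * (sin \<theta> * (d ^ m * d powr min (Re s) 0))"
        by simp
      also have "\<dots> \<le> 2 * K * pi * 2 ^ m * (sin \<theta> * ((1 - cos \<theta>) powr q + (1 + cos \<theta>) powr q))"
        unfolding d_q using d_le K sin by (intro mult_left_mono) auto
      finally show ?thesis .
    qed
  qed (use x sum in simp_all)
qed

text \<open>Convergence of the series, which gives \<open>hyp2F1\<close> its meaning, takes the
  place of an explicit range for \<open>k\<close> and \<open>x\<close>. The existence of the
  integral is part of the conclusion.\<close>

theorem mainTheorem8:
  fixes p :: nat and k x :: complex
  assumes "odd p"
    and "k \<noteq> 0"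
    and "summable (hyp2F1_term (- 1 / (2 * k)) ((k - 1) / (2 * k)) ((of_nat p + 2) / 2) (x\<^sup>2))"
  shows "((\<lambda>\<theta>::real. of_real \<theta> * of_real (sin \<theta>) ^ p *
            ((1 + x * of_real (cos \<theta>)) powr (1 / k) + (1 - x * of_real (cos \<theta>)) powr (1 / k)))
          has_integral
            (2 ^ ((p + 1) div 2) * fact ((p - 1) div 2) * of_real pi / of_nat (odd_double_fact p) *
             hyp2F1 (- 1 / (2 * k)) ((k - 1) / (2 * k)) ((of_nat p + 2) / 2) (x\<^sup>2)))
         {0..pi}"
proof -
  obtain m where p: "p = 2 * m + 1"
    using \<open>odd p\<close> by (elim oddE)
  define s where "s = 1 / k"
  have s: "s \<noteq> 0" using \<open>k \<noteq> 0\<close> by (simp add: s_def)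
  have a: "- 1 / (2 * k) = - s / 2" and b: "(k - 1) / (2 * k) = (1 - s) / 2"
    and c: "(of_nat p + 2) / 2 = (of_nat m + 3 / 2 :: complex)"
    using \<open>k \<noteq> 0\<close> by (simp_all add: s_def p field_simps)
  have sum: "summable (hyp2F1_term (- s / 2) ((1 - s) / 2) (of_nat m + 3 / 2) (x\<^sup>2))"
    using assms(3) unfolding a b c .
  have "(theta_sin_powr (2 * m + 1) s x has_integral
            theta_sin_const m * hyp2F1 (- s / 2) ((1 - s) / 2) (of_nat m + 3 / 2) (x\<^sup>2)) {0..pi}"
  proof (cases "s \<in> \<nat>")
    case True
    then show ?thesis using s by (rule has_integral_theta_sin_powr_Nats)
  next
    case False
    \<comment> \<open>The series terminates through the first upper parameter if \<open>s\<close> is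
      an even natural number, and through the second if it is odd.\<close>
    have a': "- s / 2 \<notin> \<int>\<^sub>\<le>\<^sub>0"
    proof
      assume "- s / 2 \<in> \<int>\<^sub>\<le>\<^sub>0"
      then obtain n where "- s / 2 = - of_nat n" by (elim nonpos_Ints_cases')
      then have "s = of_nat (2 * n)" by (simp add: field_simps)
      with False show False by (metis of_nat_in_Nats)
    qed
    have b': "(1 - s) / 2 \<notin> \<int>\<^sub>\<le>\<^sub>0"
    proof
      assume "(1 - s) / 2 \<in> \<int>\<^sub>\<le>\<^sub>0"
      then obtain n where "(1 - s) / 2 = - of_nat n" by (elim nonpos_Ints_cases')
      then have "s = of_nat (2 * n + 1)" by (simp add: field_simps)
      with False show False by (metis of_nat_in_Nats)
    qed
    have c': "(of_nat m + 3 / 2 :: complex) \<notin> \<int>\<^sub>\<le>\<^sub>0"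
    proof
      assume "(of_nat m + 3 / 2 :: complex) \<in> \<int>\<^sub>\<le>\<^sub>0"
      then obtain n where "(of_nat m + 3 / 2 :: complex) = - of_nat n" by (elim nonpos_Ints_cases')
      from arg_cong[OF this, of Re] show False by simp
    qed
    have "norm (x\<^sup>2) \<le> 1"
      using a' b' c' sum by (rule norm_le_1_if_summable_hyp2F1_term)
    then have "norm x \<le> 1"
      by (simp add: norm_power abs_square_le_1)
    then consider "norm x < 1" | "norm x = 1" "x\<^sup>2 \<noteq> 1" | "x\<^sup>2 = 1"
      by fastforce
    then show ?thesis
    proof cases
      case 1
      then show ?thesis by (rule has_integral_theta_sin_powr_inside)
    next
      case 2
      then show ?thesis using sum by (rule has_integral_theta_sin_powr_circle)
    next
      case 3
      have "Re (of_nat m + 3 / 2 - (- s / 2) - (1 - s) / 2) > 0"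
        using a' b' sum by (intro Re_pos_if_summable_hyp2F1_term_at_1) (simp_all add: 3)
      then have "Re s + real m > -1"
        by (simp add: field_simps)
      with 3 show ?thesis using sum by (rule has_integral_theta_sin_powr_at_1)
    qed
  qed
  moreover have "(p + 1) div 2 = m + 1" "(p - 1) div 2 = m"
    by (simp_all add: p)
  ultimately show ?thesis
    unfolding a b c s_def[symmetric]
    by (simp only: p theta_sin_powr_def[abs_def] theta_sin_const_def)
qed

end
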